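(* Let $a\in\mathbb{R}$, $q,r\in\mathbb{R}$ with $q\ne0$, and $\mathfrak{S}=\{x\in\mathbb{C}: -1\le \operatorname{Im}(x)\le 0\}$. Let $F$ be a complex function analytic on an open set containing $\{a\,x(x+i): x\in\mathfrak{S}\}$ such that, uniformly for $x\in\mathfrak{S}$ as $\operatorname{Re}(x)\to\pm\infty$, $F(a\,x(x+i))=o\!\left(e^{\pi|x|}/|x|\right)$ and $\dfrac{F(a\,x(x+i))}{\sinh^3(\pi(q+ir)(2x+i))}\to0$. Assume that the integrand below has no pole on the real axis (automatic if $(q^2+r^2)/q$ is not an integer). Put $$M=\left\lfloor\frac{q^2+r^2}{|q|}\right\rfloor,\qquad x_n=\frac{a\,(q+ir-n)(q+ir+n)}{(q+ir)^2}.$$ Then $$\pi\int_{-\infty}^{\infty}\frac{F(a\,x(x+i))}{\sinh^3(\pi(q+ir)(i+2x))}\,dx=\frac{i\pi}{4}\frac{F(a/4)}{q+ir}-\frac{i\,a}{8\pi(q+ir)^3}F'(a/4)+\frac{i\pi}{2(q+ir)}\sum_{n=1}^{M}(-1)^nF(x_n/4)$$ $$-\frac{i\,a}{4\pi(q+ir)^3}\sum_{n=1}^{M}(-1)^nF'(x_n/4)+\frac{i\,a^2}{8\pi(q+ir)^5}\sum_{n=1}^{M}(-1)^n n^2F''(x_n/4).$$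
   Context: The integral over the real line is understood as $\lim_{R\to\infty}\int_{-R}^{R}$ (removable singularities of the integrand being filled in). $\lfloor y\rfloor$ is the greatest integer not exceeding $y$; an empty sum is $0$. $F'$ and $F''$ are the first and second complex derivatives of $F$. *)

theory Defs
  imports "HOL-Complex_Analysis.Complex_Analysis" "HOL-Library.Landau_Symbols"
begin

definition strip :: "complex set" where
  "strip = {x. -1 \<le> Im x \<and> Im x \<le> 0}"

text \<open>
  A limit (or an o-estimate) along this filter is a limit as the real part tends to plus or minus
  infinity, uniformly for points of the strip.
\<close>
definition strip_ends :: "complex filter" where
  "strip_ends = inf (filtercomap (\<lambda>x. \<bar>Re x\<bar>) at_top) (principal strip)"

lemma eventually_strip_ends:
  "eventually P strip_ends \<longleftrightarrow> (\<exists>B. \<forall>x\<in>strip. B \<le> \<bar>Re x\<bar> \<longrightarrow> P x)"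
  unfolding strip_ends_def eventually_inf_principal
  by (subst eventually_filtercomap_at_top_linorder) auto

definition integrand :: "(complex \<Rightarrow> complex) \<Rightarrow> real \<Rightarrow> complex \<Rightarrow> complex \<Rightarrow> complex" where
  "integrand F a w x =
     F (of_real a * x * (x + \<i>)) / sinh (of_real pi * w * (\<i> + 2 * x)) ^ 3"

text \<open>
  The integral over the real line as the limit of the integrals over \<open>{-R..R}\<close>. Since both
  \<^const>\<open>integral\<close> and \<^const>\<open>Lim\<close> are total, existence is a separate predicate.
\<close>
definition line_integrable :: "(real \<Rightarrow> complex) \<Rightarrow> bool" where
  "line_integrable f \<longleftrightarrow>
     (\<forall>R. f integrable_on {-R..R}) \<and> (\<exists>I. ((\<lambda>R. integral {-R..R} f) \<longlongrightarrow> I) at_top)"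

definition line_integral :: "(real \<Rightarrow> complex) \<Rightarrow> complex" where
  "line_integral f = Lim at_top (\<lambda>R. integral {-R..R} f)"

end

theory Submission
  imports Defs
begin

text \<open>
  Write \<open>G\<close> for the integrand with its removable singularities filled in. The argument
  \<open>a x (x + \<i>)\<close> of \<open>F\<close> is invariant under the reflection \<open>x \<mapsto> - \<i> - x\<close> about the centre of the
  strip, and \<open>sinh\<^sup>3\<close> is odd under it, so \<open>G (- \<i> - x) = - G x\<close>. The two horizontal edges of the
  rectangle with real parts in \<open>[-R, R]\<close> and imaginary parts in \<open>[-1, 0]\<close> are exchanged by the
  reflection and therefore contribute equally to the contour integral of \<open>G\<close>: each contributes minus
  the integral of \<open>G\<close> over \<open>[-R, R]\<close>. The vertical edges have length \<open>1\<close>, and \<open>G\<close> tends to \<open>0\<close>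
  uniformly at the ends of the strip. By the residue theorem the truncated integrals thus converge
  to \<open>- \<pi> \<i>\<close> times the sum of the residues inside the strip; the same argument yields their
  convergence (\<open>strip_integral_residues\<close>).

  With \<open>w = q + \<i> r\<close>, the zeros of the denominator are \<open>\<i> (n / w - 1) / 2\<close> for integers \<open>n\<close>, and those
  in the closed strip are the ones with \<open>\<bar>n\<bar> \<le> M\<close>. At such a point the argument of \<open>F\<close> equals
  \<open>x\<^sub>n / 4\<close>. The residue at a triple zero reduces to one at a simple zero by the identity
  \<open>csch\<^sup>3 = (csch'' - csch) / 2\<close>: integrating by parts twice moves the two derivatives onto the
  holomorphic factor, because a derivative has no residue (\<open>residue_over_sinh_cubed\<close>). The second
  derivative of \<open>x \<mapsto> F (a x (x + \<i>))\<close> supplies the terms with \<open>F'\<close> and \<open>F''\<close>. The residues at \<open>n\<close>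
  and \<open>-n\<close> agree, which gives the factor two between the terms of the sums over \<open>n \<ge> 1\<close> and the
  terms for \<open>n = 0\<close>.
\<close>

section \<open>The residue at a triple zero of the hyperbolic sine\<close>

text \<open>The residue is a multiple of the integral over a small circle, where the derivative has a
  primitive.\<close>
lemma residue_deriv_eq_0:
  assumes "open S" "p \<in> S" "E holomorphic_on S - {p}"
  shows "residue (deriv E) p = 0"
proof -
  from assms obtain e where e: "e > 0" "cball p e \<subseteq> S"
    using open_contains_cball by blast
  have op: "open (S - {p})" using assms by blast
  have "(deriv E has_contour_integral 2 * pi * \<i> * residue (deriv E) p) (circlepath p e)"
    by (rule base_residue[OF assms(1,2) e(1) holomorphic_deriv[OF assms(3) op] e(2)])
  moreover have "(deriv E has_contour_integral
      (E (pathfinish (circlepath p e)) - E (pathstart (circlepath p e)))) (circlepath p e)"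
    using e by (intro contour_integral_primitive[where S = "S - {p}"] holomorphic_derivI[OF assms(3) op])
      auto
  ultimately have "2 * pi * \<i> * residue (deriv E) p = 0"
    using has_contour_integral_unique by fastforce
  then show ?thesis by simp
qed

text \<open>
  With \<open>K = 1 / sinh (c z + d)\<close> one has \<open>K\<^sup>3 = (K'' / c\<^sup>2 - K) / 2\<close>, and
  \<open>H K'' = (H K' - H' K)' + H'' K\<close>. Hence \<open>H K\<^sup>3\<close> differs by a derivative from
  \<open>(H'' / c\<^sup>2 - H) K / 2\<close>, which has at most a simple pole.
\<close>
lemma residue_over_sinh_cubed:
  fixes c d p :: complex
  assumes S: "open S" "p \<in> S" and H: "H holomorphic_on S"
    and c: "c \<noteq> 0" and zero: "sinh (c * p + d) = 0"
  shows "residue (\<lambda>z. H z / sinh (c * z + d) ^ 3) p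
       = (deriv (deriv H) p / c\<^sup>2 - H p) / (2 * c * cosh (c * p + d))"
proof -
  define s where "s z = sinh (c * z + d)" for z
  define k where "k z = cosh (c * z + d)" for z
  \<comment> \<open>\<open>E\<close> is \<open>(H K' - H' K) / (2 c\<^sup>2)\<close>, since \<open>K' = - c k / s\<^sup>2\<close>.\<close>
  define E where "E z = - (c * H z * k z / s z ^ 2 + deriv H z / s z) / (2 * c\<^sup>2)" for z
  define Q where "Q z = (deriv (deriv H) z / c\<^sup>2 - H z) / 2" for z
  have ks: "k z ^ 2 = s z ^ 2 + 1" for z
    by (simp add: k_def s_def cosh_square_eq)
  have sp: "s p = 0" and kp: "k p \<noteq> 0"
    using zero ks[of p] by (auto simp: s_def)
  have ds: "(s has_field_derivative c * k z) (at z)" for z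
    unfolding s_def k_def by (auto intro!: derivative_eq_intros)
  have dk: "(k has_field_derivative c * s z) (at z)" for z
    unfolding s_def k_def by (auto intro!: derivative_eq_intros)
  have s_holo: "s holomorphic_on A" and k_holo: "k holomorphic_on A" for A
    by (auto simp: s_def[abs_def] k_def[abs_def] intro!: analytic_imp_holomorphic analytic_intros)
  have "(\<lambda>z. (s z - s p) / (z - p)) \<midarrow>p\<rightarrow> c * k p"
    using ds[of p] by (simp add: has_field_derivative_iff)
  then have "\<forall>\<^sub>F z in at p. (s z - s p) / (z - p) \<noteq> 0"
    by (rule tendsto_imp_eventually_ne) (use c kp in auto)
  then obtain A where A: "open A" "p \<in> A" "\<And>z. z \<in> A \<Longrightarrow> z \<noteq> p \<Longrightarrow> s z \<noteq> 0"
    unfolding eventually_at_topological using sp by auto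
  define T where "T = S \<inter> A"
  have T: "open T" "p \<in> T" "H holomorphic_on T" "\<And>z. z \<in> T - {p} \<Longrightarrow> s z \<noteq> 0"
    using S A H by (auto simp: T_def intro: holomorphic_on_subset)
  have H': "deriv H holomorphic_on T" "deriv (deriv H) holomorphic_on T"
    using T by (auto intro!: holomorphic_deriv)
  have E_holo: "E holomorphic_on T - {p}"
    unfolding E_def using T H' c
    by (auto intro!: holomorphic_intros s_holo k_holo intro: holomorphic_on_subset)
  have Q_holo: "Q holomorphic_on T"
    unfolding Q_def using T H' c by (auto intro!: holomorphic_intros)
  have split: "H z / s z ^ 3 = deriv E z + Q z / s z" if z: "z \<in> T - {p}" for z
  proof -
    have sz: "s z \<noteq> 0" using T(4) z by blast
    have h0: "(H has_field_derivative deriv H z) (at z)"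
      using holomorphic_derivI[OF T(3,1)] z by blast
    have h1: "(deriv H has_field_derivative deriv (deriv H) z) (at z)"
      using holomorphic_derivI[OF H'(1) T(1)] z by blast
    have "((\<lambda>z. c * H z * k z) has_field_derivative c * deriv H z * k z + c * H z * (c * s z)) (at z)"
      by (auto intro!: derivative_eq_intros h0 dk)
    moreover have "((\<lambda>z. s z ^ 2) has_field_derivative 2 * s z * (c * k z)) (at z)"
      by (auto intro!: derivative_eq_intros ds)
    ultimately have "((\<lambda>z. c * H z * k z / s z ^ 2 + deriv H z / s z) has_field_derivative
        ((c * deriv H z * k z + c * H z * (c * s z)) * s z ^ 2
            - c * H z * k z * (2 * s z * (c * k z))) / (s z ^ 2 * s z ^ 2)
          + (deriv (deriv H) z * s z - deriv H z * (c * k z)) / (s z * s z)) (at z)"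
      using sz by (intro DERIV_add DERIV_divide h1 ds) auto
    then have "(E has_field_derivative
        - (((c * deriv H z * k z + c * H z * (c * s z)) * s z ^ 2
            - c * H z * k z * (2 * s z * (c * k z))) / (s z ^ 2 * s z ^ 2)
          + (deriv (deriv H) z * s z - deriv H z * (c * k z)) / (s z * s z)) / (2 * c\<^sup>2)) (at z)"
      unfolding E_def by (intro DERIV_cdivide DERIV_minus)
    then have "deriv E z = - (((c * deriv H z * k z + c * H z * (c * s z)) * s z ^ 2
            - 2 * c\<^sup>2 * H z * (k z)\<^sup>2 * s z) / (s z ^ 2 * s z ^ 2)
          + (deriv (deriv H) z * s z - deriv H z * (c * k z)) / (s z * s z)) / (2 * c\<^sup>2)"
      using DERIV_imp_deriv by (simp add: power2_eq_square mult_ac)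
    then have "deriv E z + Q z / s z = H z / s z ^ 3"
      unfolding ks Q_def using sz c
      by (simp add: divide_simps power2_eq_square power3_eq_cube power4_eq_xxxx) algebra
    then show ?thesis by simp
  qed
  have "residue (\<lambda>z. H z / s z ^ 3) p = residue (\<lambda>z. deriv E z + Q z / s z) p"
  proof (rule residue_cong)
    show "\<forall>\<^sub>F z in at p. H z / s z ^ 3 = deriv E z + Q z / s z"
      unfolding eventually_at_topological using T(1,2) split by blast
  qed simp
  also have "\<dots> = residue (deriv E) p + residue (\<lambda>z. Q z / s z) p"
  proof (rule residue_add[OF T(1,2)])
    show "deriv E holomorphic_on T - {p}"
      using E_holo T(1) by (intro holomorphic_deriv) auto
    show "(\<lambda>z. Q z / s z) holomorphic_on T - {p}"
      using Q_holo T(4) by (auto intro!: holomorphic_intros s_holo intro: holomorphic_on_subset)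
  qed
  also have "residue (deriv E) p = 0"
    by (rule residue_deriv_eq_0[OF T(1,2) E_holo])
  also have "residue (\<lambda>z. Q z / s z) p = Q p / (c * k p)"
  proof (rule residue_simple'[OF T(1,2)])
    show "(\<lambda>z. Q z / s z) holomorphic_on T - {p}"
      using Q_holo T(4) by (auto intro!: holomorphic_intros s_holo intro: holomorphic_on_subset)
    have "isCont Q p"
      using Q_holo T(1,2) holomorphic_on_imp_continuous_on continuous_on_eq_continuous_at by blast
    then have "(\<lambda>z. Q z / ((s z - s p) / (z - p))) \<midarrow>p\<rightarrow> Q p / (c * k p)"
      using ds[of p] c kp
      by (intro tendsto_divide) (auto simp: has_field_derivative_iff isCont_def)
    then show "(\<lambda>z. Q z / s z * (z - p)) \<midarrow>p\<rightarrow> Q p / (c * k p)"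
      by (simp add: sp)
  qed
  finally show ?thesis
    by (simp add: s_def k_def Q_def)
qed

section \<open>Zeros of the denominator\<close>

lemma sinh_eq_0_complex:
  fixes z :: complex
  shows "sinh z = 0 \<longleftrightarrow> (\<exists>n::int. z = \<i> * of_int n * of_real pi)"
proof -
  have "sinh z = 0 \<longleftrightarrow> (\<exists>n::int. \<i> * z = of_real (n * pi))"
    by (simp add: sinh_conv_sin sin_eq_0)
  also have "\<dots> \<longleftrightarrow> (\<exists>n::int. z = \<i> * of_int n * of_real pi)"
  proof safe
    fix n :: int assume "\<i> * z = of_real (n * pi)"
    then have "\<i> * (\<i> * z) = \<i> * of_real (n * pi)" by simp
    then have "z = \<i> * of_int (-n) * of_real pi" by (simp add: mult.assoc) (metis minus_minus)
    then show "\<exists>n::int. z = \<i> * of_int n * of_real pi" by blast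
  next
    fix n :: int assume "z = \<i> * of_int n * of_real pi"
    show "\<exists>m::int. \<i> * (\<i> * of_int n * of_real pi) = complex_of_real (of_int m * pi)"
      by (rule exI[of _ "-n"]) (simp add: complex_eq_iff)
  qed
  finally show ?thesis .
qed

definition csch_pole :: "complex \<Rightarrow> int \<Rightarrow> complex" where
  "csch_pole w n = \<i> * (of_int n / w - 1) / 2"

lemma sinh_eq_0_iff_csch_pole:
  assumes "w \<noteq> 0"
  shows "sinh (of_real pi * w * (\<i> + 2 * x)) = 0 \<longleftrightarrow> (\<exists>n. x = csch_pole w n)"
proof -
  have "of_real pi * w * (\<i> + 2 * x) = \<i> * of_int n * of_real pi \<longleftrightarrow> x = csch_pole w n" for n
  proof -
    have "of_real pi * w * (\<i> + 2 * x) = \<i> * of_int n * of_real pi \<longleftrightarrow> w * (\<i> + 2 * x) = \<i> * of_int n"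
      by (simp add: mult.assoc mult.commute[of _ "complex_of_real pi"] mult.left_commute[of _ "complex_of_real pi"])
    also have "\<dots> \<longleftrightarrow> x = csch_pole w n"
      using assms by (auto simp: csch_pole_def field_simps)
    finally show ?thesis .
  qed
  then show ?thesis by (simp add: sinh_eq_0_complex)
qed

lemma Im_csch_pole: "Im (csch_pole w n) = (of_int n * Re w / (cmod w)\<^sup>2 - 1) / 2"
  by (simp add: csch_pole_def Re_divide cmod_power2)

lemma csch_pole_in_strip_iff:
  assumes "Re w \<noteq> 0"
  shows "csch_pole w n \<in> strip \<longleftrightarrow> \<bar>n\<bar> \<le> \<lfloor>(cmod w)\<^sup>2 / \<bar>Re w\<bar>\<rfloor>"
proof -
  have w: "(cmod w)\<^sup>2 > 0" using assms by auto
  have "csch_pole w n \<in> strip \<longleftrightarrow> \<bar>of_int n * Re w / (cmod w)\<^sup>2\<bar> \<le> 1"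
    unfolding strip_def mem_Collect_eq Im_csch_pole abs_le_iff by argo
  also have "\<dots> \<longleftrightarrow> \<bar>of_int n\<bar> \<le> (cmod w)\<^sup>2 / \<bar>Re w\<bar>"
    using w assms by (simp add: abs_mult field_simps)
  also have "\<dots> \<longleftrightarrow> \<bar>n\<bar> \<le> \<lfloor>(cmod w)\<^sup>2 / \<bar>Re w\<bar>\<rfloor>"
    by (simp add: le_floor_iff)
  finally show ?thesis .
qed

text \<open>An affine map carries the zeros onto integers, and every set of integers is closed.\<close>
lemma closed_csch_poles:
  assumes "w \<noteq> 0" "A \<subseteq> range (csch_pole w)"
  shows "closed A"
proof -
  define \<eta> where "\<eta> x = - \<i> * w * (\<i> + 2 * x)" for x
  have \<eta>: "\<eta> (csch_pole w n) = of_int n" for n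
    using assms by (simp add: \<eta>_def csch_pole_def field_simps)
  have "A = \<eta> -` (\<eta> ` A)"
    using assms by (auto simp: \<eta>_def)
  moreover have "closed (\<eta> ` A)"
    using assms(2) \<eta> by (intro closed_subset_Ints) auto
  moreover have "continuous_on UNIV \<eta>"
    unfolding \<eta>_def by (intro continuous_intros)
  ultimately show ?thesis
    using continuous_closed_vimage by (metis continuous_on_eq_continuous_at open_UNIV UNIV_I)
qed

section \<open>Integrals of functions that are odd about the centre of the strip\<close>

text \<open>
  Contour integration around the rectangle over \<open>[-R, R]\<close>. The equality of the two horizontal
  contributions holds exactly for every \<open>R\<close>, so only the vertical edges need an estimate.
\<close>
lemma strip_integral_residues:
  fixes g :: "complex \<Rightarrow> complex"
  assumes V: "open V" "strip \<subseteq> V" and P: "finite P" "\<And>p. p \<in> P \<Longrightarrow> -1 < Im p \<and> Im p < 0"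
    and holo: "g holomorphic_on V - P"
    and odd: "\<And>z. g (- \<i> - z) = - g z"
    and ends: "(g \<longlongrightarrow> 0) strip_ends"
  shows "line_integrable (\<lambda>x. g (of_real x))"
    and "line_integral (\<lambda>x. g (of_real x)) = - (of_real pi * \<i> * (\<Sum>p\<in>P. residue g p))"
proof -
  define I where "I R = integral {-R..R} (\<lambda>x. g (of_real x))" for R
  define L where "L = - (of_real pi * \<i> * (\<Sum>p\<in>P. residue g p))"
  \<comment> \<open>The residue theorem asks for a connected domain.\<close>
  define V0 where "V0 = connected_component_set V 0"
  have "convex strip"
  proof -
    have "strip = {z. -1 \<le> Im z} \<inter> {z. Im z \<le> 0}" by (auto simp: strip_def)
    then show ?thesis
      using convex_halfspace_Im_ge[of "-1"] convex_halfspace_Im_le[of 0] convex_Int by force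
  qed
  moreover have "0 \<in> strip" by (simp add: strip_def)
  ultimately have V0: "open V0" "connected V0" "strip \<subseteq> V0" "V0 \<subseteq> V"
    using V connected_component_maximal[of 0 strip V] convex_connected[of strip]
    by (auto simp: V0_def open_connected_component connected_component_subset)
  have cont: "continuous_on A g" if "A \<subseteq> strip" "A \<inter> P = {}" for A
    using holomorphic_on_imp_continuous_on[OF holo] that V
    by (meson Diff_iff continuous_on_subset disjoint_iff subset_iff)
  have int_R: "(\<lambda>x. g (of_real x)) integrable_on {-R..R}" for R :: real
    by (intro integrable_continuous_real continuous_on_compose2[OF cont[of "\<real>"]])
       (use P in \<open>force simp: strip_def Reals_def intro!: continuous_intros\<close>)+
  obtain B0 where B0: "\<And>p. p \<in> P \<Longrightarrow> \<bar>Re p\<bar> < B0"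
  proof -
    have "finite ((\<lambda>p. \<bar>Re p\<bar>) ` P)" using P by simp
    then show ?thesis using that[of "Max ((\<lambda>p. \<bar>Re p\<bar>) ` P) + 1"]
      by (meson Max_ge add.commute imageI less_add_one order_le_less_trans)
  qed
  have bound: "norm (I R - L) \<le> e"
    if R: "R \<ge> B0" "R > 0" and e: "e \<ge> 0" "\<And>z. z \<in> strip \<Longrightarrow> R \<le> \<bar>Re z\<bar> \<Longrightarrow> norm (g z) \<le> e" for R e
  proof -
    let ?a = "Complex (-R) (-1)" and ?b = "Complex R (-1)" and ?c = "Complex R 0" and ?d = "Complex (-R) 0"
    let ?rect = "rectpath ?a ?c"
    have seg: "closed_segment ?a ?b = {z. Im z = -1 \<and> \<bar>Re z\<bar> \<le> R}"
      "closed_segment ?c ?d = {z. Im z = 0 \<and> \<bar>Re z\<bar> \<le> R}"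
      "closed_segment ?b ?c = {z. Re z = R \<and> -1 \<le> Im z \<and> Im z \<le> 0}"
      "closed_segment ?d ?a = {z. Re z = -R \<and> -1 \<le> Im z \<and> Im z \<le> 0}"
      using R by (auto simp: closed_segment_same_Re closed_segment_same_Im closed_segment_eq_real_ivl)
    have Preg: "p \<in> P \<Longrightarrow> -1 < Im p \<and> Im p < 0 \<and> \<bar>Re p\<bar> < R" for p
      using P B0 R by fastforce
    have ci: "g contour_integrable_on linepath ?a ?b" "g contour_integrable_on linepath ?b ?c"
      "g contour_integrable_on linepath ?c ?d" "g contour_integrable_on linepath ?d ?a"
      by (intro contour_integrable_continuous_linepath cont;
          use Preg in \<open>force simp: seg strip_def\<close>)+
    have "contour_integral ?rect g = 2 * pi * \<i> * (\<Sum>p\<in>P. winding_number ?rect p * residue g p)"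
    proof (rule Residue_theorem[OF V0(1,2) P(1)])
      show "g holomorphic_on V0 - P" using holo V0 by (auto intro: holomorphic_on_subset)
      show "path_image ?rect \<subseteq> V0 - P"
        using R V0(3) Preg by (fastforce simp: path_image_rectpath strip_def)
      show "\<forall>z. z \<notin> V0 \<longrightarrow> winding_number ?rect z = 0"
        using R V0(3) by (auto intro!: winding_number_rectpath_outside simp: in_cbox_complex_iff strip_def)
    qed auto
    also have "(\<Sum>p\<in>P. winding_number ?rect p * residue g p) = (\<Sum>p\<in>P. residue g p)"
    proof (rule sum.cong[OF HOL.refl])
      fix p assume "p \<in> P"
      then have "p \<in> box ?a ?c" using Preg[of p] by (simp add: in_box_complex_iff abs_less_iff)
      then show "winding_number ?rect p * residue g p = residue g p"
        by (simp add: winding_number_rectpath)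
    qed
    finally have rect: "contour_integral ?rect g = 2 * pi * \<i> * (\<Sum>p\<in>P. residue g p)" .
    have sides: "contour_integral ?rect g =
        contour_integral (linepath ?a ?b) g + contour_integral (linepath ?b ?c) g
        + contour_integral (linepath ?c ?d) g + contour_integral (linepath ?d ?a) g"
      using ci by (simp add: rectpath_def Let_def)
    have bottom: "contour_integral (linepath ?a ?b) g = contour_integral (linepath ?c ?d) g"
    proof -
      have "linepath ?a ?b t = - \<i> - linepath ?c ?d t" for t
        by (simp add: linepath_def complex_eq_iff algebra_simps)
      moreover have "?b - ?a = - (?d - ?c)" by (simp add: complex_eq_iff)
      ultimately have "g (linepath ?a ?b t) * (?b - ?a) = g (linepath ?c ?d t) * (?d - ?c)" for t
        by (simp only: odd minus_mult_minus)
      then show ?thesis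
        unfolding contour_integral_integral by (simp only: vector_derivative_linepath_at)
    qed
    have top: "contour_integral (linepath ?c ?d) g = - I R"
    proof -
      have "contour_integral (linepath ?c ?d) g = - contour_integral (linepath ?d ?c) g"
        by (rule contour_integral_reverse_linepath, rule cont)
           (use Preg in \<open>force simp: seg strip_def\<close>)+
      also have "contour_integral (linepath ?d ?c) g = I R"
        using contour_integral_linepath_Reals_eq[of ?d ?c g] R
        by (simp add: I_def complex_is_Real_iff)
      finally show ?thesis .
    qed
    have right: "norm (contour_integral (linepath ?b ?c) g) \<le> e"
      using contour_integral_bound_linepath[OF ci(2), of e] e R
      by (auto simp: seg strip_def cmod_def)
    have left: "norm (contour_integral (linepath ?d ?a) g) \<le> e"
      using contour_integral_bound_linepath[OF ci(4), of e] e R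
      by (auto simp: seg strip_def cmod_def)
    have "2 * (I R - L) = contour_integral (linepath ?b ?c) g + contour_integral (linepath ?d ?a) g"
      using rect sides bottom top by (simp add: L_def algebra_simps)
    then have "norm (2 * (I R - L)) \<le> e + e"
      using right left norm_triangle_le by (metis add_mono)
    moreover have "norm (2 * (I R - L)) = 2 * norm (I R - L)"
      by (simp only: norm_mult norm_numeral)
    ultimately show ?thesis by simp
  qed
  have lim: "(I \<longlongrightarrow> L) at_top"
  proof (rule tendstoI)
    fix e :: real assume e: "e > 0"
    from tendstoD[OF ends, of "e / 2"] e
    obtain B where B: "\<And>z. z \<in> strip \<Longrightarrow> B \<le> \<bar>Re z\<bar> \<Longrightarrow> norm (g z) < e / 2"
      unfolding eventually_strip_ends by auto
    have "eventually (\<lambda>R::real. R \<ge> max (max B B0) 1) at_top"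
      by (rule eventually_ge_at_top)
    then show "\<forall>\<^sub>F R in at_top. dist (I R) L < e"
    proof eventually_elim
      case (elim R)
      have "norm (I R - L) \<le> e / 2"
        by (rule bound) (use elim e B in \<open>auto intro!: less_imp_le\<close>)
      then show ?case using e by (simp add: dist_norm)
    qed
  qed
  show "line_integrable (\<lambda>x. g (of_real x))"
    unfolding line_integrable_def using int_R lim by (auto simp: I_def[abs_def])
  show "line_integral (\<lambda>x. g (of_real x)) = - (of_real pi * \<i> * (\<Sum>p\<in>P. residue g p))"
    unfolding line_integral_def using tendsto_Lim[OF _ lim] by (simp add: I_def[abs_def] L_def)
qed


text \<open>Holds also where the limit fails to exist, since there \<^const>\<open>remove_sings\<close> has the value
  \<open>0\<close> on both sides.\<close>
lemma remove_sings_reflect_odd: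
  assumes "\<And>z. f (c - z) = - f z"
  shows "remove_sings f (c - z) = - remove_sings f z"
proof -
  have 1: "f \<midarrow>c - z\<rightarrow> - l" if "f \<midarrow>z\<rightarrow> l" for l z
  proof -
    have "((\<lambda>x. c - x) \<longlongrightarrow> c - (c - z)) (at (c - z))" by (intro tendsto_intros)
    then have "filterlim (\<lambda>x. c - x) (at z) (at (c - z))"
      by (auto simp: filterlim_at eventually_at_filter intro!: always_eventually)
    from filterlim_compose[OF that this]
    have "(\<lambda>x. - f x) \<midarrow>c - z\<rightarrow> l" by (simp add: assms)
    then show ?thesis using tendsto_minus_cancel_left by blast
  qed
  show ?thesis
  proof (cases "\<exists>l. f \<midarrow>z\<rightarrow> l")
    case True
    then obtain l where l: "f \<midarrow>z\<rightarrow> l" by blast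
    then have "remove_sings f z = l" by (rule remove_sings_eqI)
    with remove_sings_eqI[OF 1[OF l]] show ?thesis by simp
  next
    case False
    then have "\<nexists>l. f \<midarrow>c - z\<rightarrow> l" using 1[where z = "c - z"] by auto
    with False show ?thesis by (simp add: remove_sings_def)
  qed
qed

section \<open>The closed form\<close>

lemma sum_even_int:
  fixes \<phi> :: "int \<Rightarrow> 'a::comm_semiring_1"
  assumes "\<And>n. \<phi> (- n) = \<phi> n"
  shows "(\<Sum>n = - int M..int M. \<phi> n) = \<phi> 0 + 2 * (\<Sum>n = 1..M. \<phi> (int n))"
proof (induction M)
  case (Suc M)
  have "{- int (Suc M)..int (Suc M)} = insert (- int (Suc M)) (insert (int (Suc M)) {- int M..int M})"
    by auto
  then show ?case using Suc assms[of "int (Suc M)"] by (simp add: algebra_simps mult_2)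
qed simp

lemma deriv_deriv_comp_parabola:
  fixes a :: complex
  assumes "open U" "F holomorphic_on U" "a * z * (z + \<i>) \<in> U"
  shows "deriv (deriv (\<lambda>x. F (a * x * (x + \<i>)))) z
    = (a * (2 * z + \<i>))\<^sup>2 * deriv (deriv F) (a * z * (z + \<i>)) + 2 * a * deriv F (a * z * (z + \<i>))"
proof -
  define h where "h x = a * x * (x + \<i>)" for x
  define V where "V = h -` U"
  have dh: "(h has_field_derivative a * (2 * x + \<i>)) (at x)" for x
    unfolding h_def by (auto intro!: derivative_eq_intros simp: algebra_simps)
  have V: "open V" "z \<in> V"
    using assms unfolding V_def h_def by (auto intro!: continuous_open_vimage continuous_intros)
  have F': "deriv F holomorphic_on U" using assms by (intro holomorphic_deriv)
  have d1: "((\<lambda>x. F (h x)) has_field_derivative deriv F (h x) * (a * (2 * x + \<i>))) (at x)" if "x \<in> V" for x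
    by (rule DERIV_chain2[OF holomorphic_derivI[OF assms(2,1)] dh]) (use that in \<open>simp add: V_def\<close>)
  have "((\<lambda>x. deriv F (h x)) has_field_derivative deriv (deriv F) (h z) * (a * (2 * z + \<i>))) (at z)"
    by (rule DERIV_chain2[OF holomorphic_derivI[OF F' assms(1)] dh]) (use V in \<open>simp add: V_def\<close>)
  then have "((\<lambda>x. deriv F (h x) * (a * (2 * x + \<i>))) has_field_derivative
      (a * (2 * z + \<i>))\<^sup>2 * deriv (deriv F) (h z) + 2 * a * deriv F (h z)) (at z)"
    by (auto intro!: derivative_eq_intros simp: power2_eq_square algebra_simps)
  then have "(deriv (\<lambda>x. F (h x)) has_field_derivative
      (a * (2 * z + \<i>))\<^sup>2 * deriv (deriv F) (h z) + 2 * a * deriv F (h z)) (at z)"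
    by (rule has_field_derivative_transform_within_open[OF _ V]) (simp add: DERIV_imp_deriv[OF d1])
  then show ?thesis
    unfolding h_def by (rule DERIV_imp_deriv)
qed

theorem mainTheorem7:
  fixes a q r :: real and F :: "complex \<Rightarrow> complex" and U :: "complex set"
    and w :: complex and M :: nat and X :: "nat \<Rightarrow> complex" and f :: "real \<Rightarrow> complex"
  defines "w \<equiv> of_real q + \<i> * of_real r"
    and "M \<equiv> nat \<lfloor>(q\<^sup>2 + r\<^sup>2) / \<bar>q\<bar>\<rfloor>"
    and "X \<equiv> (\<lambda>n. of_real a * (w - of_nat n) * (w + of_nat n) / w\<^sup>2)"
    and "f \<equiv> (\<lambda>x. remove_sings (integrand F a w) (of_real x))"
  assumes "q \<noteq> 0"
    and "open U" and "(\<lambda>x. of_real a * x * (x + \<i>)) ` strip \<subseteq> U" and "F analytic_on U"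
    and "(\<lambda>x. F (of_real a * x * (x + \<i>)))
           \<in> o[strip_ends](\<lambda>x. of_real (exp (pi * cmod x) / cmod x))"
    and "((\<lambda>x. F (of_real a * x * (x + \<i>)) / sinh (of_real pi * w * (2 * x + \<i>)) ^ 3)
           \<longlongrightarrow> 0) strip_ends"
    and "\<And>x::real. \<not> is_pole (integrand F a w) (of_real x)"
  shows "line_integrable f \<and>
         of_real pi * line_integral f =
           \<i> * of_real pi / 4 * (F (of_real a / 4) / w)
           - \<i> * of_real a / (8 * of_real pi * w ^ 3) * deriv F (of_real a / 4)
           + \<i> * of_real pi / (2 * w) * (\<Sum>n=1..M. (-1) ^ n * F (X n / 4))
           - \<i> * of_real a / (4 * of_real pi * w ^ 3) * (\<Sum>n=1..M. (-1) ^ n * deriv F (X n / 4))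
           + \<i> * of_real (a\<^sup>2) / (8 * of_real pi * w ^ 5)
               * (\<Sum>n=1..M. (-1) ^ n * of_nat (n\<^sup>2) * deriv (deriv F) (X n / 4))"
proof -
  define G where "G = integrand F a w"
  define g where "g = remove_sings G"
  define h where "h x = of_real a * x * (x + \<i>)" for x :: complex
  define V where "V = h -` U"
  define Z where "Z = range (csch_pole w)"
  define m where "m = int M"
  define N where "N = {- m..m}"
  have w: "w \<noteq> 0" "Re w = q" "(cmod w)\<^sup>2 = q\<^sup>2 + r\<^sup>2"
    using assms(5) by (auto simp: w_def cmod_power2 complex_eq_iff)
  have m: "m = \<lfloor>(cmod w)\<^sup>2 / \<bar>Re w\<bar>\<rfloor>"
    by (simp add: m_def M_def w)
  have in_strip: "csch_pole w n \<in> strip \<longleftrightarrow> n \<in> N" for n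
    using csch_pole_in_strip_iff[of w n] w assms(5) by (auto simp: m N_def abs_le_iff)
  have F: "F holomorphic_on U"
    using assms(8) by (rule analytic_imp_holomorphic)
  have V: "open V" "strip \<subseteq> V"
    using assms(6,7) unfolding V_def h_def by (auto intro!: continuous_open_vimage continuous_intros)
  have Z: "sinh (of_real pi * w * (\<i> + 2 * x)) = 0 \<longleftrightarrow> x \<in> Z" for x
    using sinh_eq_0_iff_csch_pole[OF w(1)] by (auto simp: Z_def)
  have G_eq: "G x = F (h x) / sinh (of_real pi * w * (\<i> + 2 * x)) ^ 3" for x
    by (simp add: G_def integrand_def h_def)
  have Fh: "(\<lambda>x. F (h x)) holomorphic_on V"
  proof -
    have "h holomorphic_on V" unfolding h_def by (intro holomorphic_intros)
    then show ?thesis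
      using holomorphic_on_compose_gen[OF _ F, of h V] by (simp add: V_def o_def)
  qed
  have G_mero: "G meromorphic_on V"
    unfolding G_eq[abs_def] using Fh V(1)
    by (intro meromorphic_intros analytic_on_imp_meromorphic_on analytic_intros)
       (simp add: analytic_on_open)
  have G_an: "G analytic_on {z}" if "z \<in> V" "z \<notin> Z" for z
  proof -
    have "(\<lambda>x. F (h x)) analytic_on {z}" using Fh V(1) that(1) analytic_at by blast
    then show ?thesis
      unfolding G_eq[abs_def] using Z that(2) by (intro analytic_intros) auto
  qed
  have g_eq: "g z = G z" if "z \<in> V" "z \<notin> Z" for z
    using G_an[OF that] by (simp add: g_def)
  \<comment> \<open>The quadratic \<open>x (x + \<i>)\<close> is invariant under \<open>x \<mapsto> - \<i> - x\<close>, while the cubed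
    hyperbolic sine changes sign.\<close>
  have g_odd: "g (- \<i> - z) = - g z" for z
    unfolding g_def
  proof (rule remove_sings_reflect_odd)
    fix z
    have "h (- \<i> - z) = h z" by (simp add: h_def algebra_simps)
    moreover have "of_real pi * w * (\<i> + 2 * (- \<i> - z)) = - (of_real pi * w * (\<i> + 2 * z))"
      by (simp add: algebra_simps)
    ultimately show "G (- \<i> - z) = - G z"
      unfolding G_eq by (simp only: sinh_minus power3_eq_cube mult_minus_left mult_minus_right minus_minus minus_divide_right)
  qed
  have g_real: "g analytic_on {z}" if "Im z = 0" for z
  proof -
    have "z \<in> V" using that V(2) by (auto simp: strip_def)
    then have "isolated_singularity_at G z" "not_essential G z"
      using G_mero by (auto simp: meromorphic_on_altdef)
    moreover have "\<not> is_pole G z"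
      using assms(11)[of "Re z"] that by (simp add: G_def complex_eq_iff flip: complex_is_Real_iff)
    ultimately show ?thesis
      unfolding g_def not_essential_def using remove_sings_analytic_at by blast
  qed
  \<comment> \<open>Only poles on the real axis are excluded by hypothesis; the symmetry carries this over to
    the lower edge of the strip.\<close>
  have g_lower: "g analytic_on {z}" if "Im z = -1" for z
  proof -
    have "g analytic_on {- \<i> - z}" by (rule g_real) (simp add: that)
    moreover have "(\<lambda>x. - \<i> - x) analytic_on {z}" by (intro analytic_intros)
    ultimately have "(\<lambda>x. g (- \<i> - x)) analytic_on {z}"
      using analytic_on_compose[of "\<lambda>x. - \<i> - x" "{z}" g] by (simp add: o_def)
    then have "(\<lambda>x. - g (- \<i> - x)) analytic_on {z}" by (intro analytic_intros)
    then show ?thesis by (simp add: g_odd)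
  qed

  \<comment> \<open>\<open>P\<close> holds the zeros inside the strip. Zeros on its edges are removable singularities, and
    the zeros outside it are cut out of the domain, which stays open because they form a closed
    set.\<close>
  define P where "P = {p \<in> csch_pole w ` N. -1 < Im p \<and> Im p < 0}"
  define W where "W = V - (Z - strip)"
  have W: "open W" "strip \<subseteq> W"
    using V closed_csch_poles[OF w(1), of "Z - strip"] by (auto simp: W_def Z_def)
  have g_holo: "g holomorphic_on W - P"
  proof -
    have "g analytic_on {z}" if "z \<in> W - P" for z
    proof (cases "z \<in> Z")
      case False
      then show ?thesis
        using that G_an remove_sings_analytic_on unfolding W_def g_def by blast
    next
      case True
      then have "z \<in> strip" using that by (auto simp: W_def)
      then have "z \<in> csch_pole w ` N" using True in_strip by (auto simp: Z_def)
      then have "Im z = 0 \<or> Im z = -1"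
        using that \<open>z \<in> strip\<close> by (auto simp: P_def strip_def)
      then show ?thesis using g_real g_lower by blast
    qed
    then show ?thesis using analytic_on_analytic_at analytic_imp_holomorphic by blast
  qed
  have g_ends: "(g \<longlongrightarrow> 0) strip_ends"
  proof -
    have "finite ((\<lambda>p. \<bar>Re p\<bar>) ` csch_pole w ` N)" by (simp add: N_def)
    then obtain B where "\<forall>b \<in> (\<lambda>p. \<bar>Re p\<bar>) ` csch_pole w ` N. b < B"
      by (meson Max_ge less_add_one order_le_less_trans)
    then have B: "\<bar>Re (csch_pole w n)\<bar> < B" if "n \<in> N" for n using that by auto
    have "\<forall>\<^sub>F x in strip_ends. g x = F (of_real a * x * (x + \<i>)) / sinh (of_real pi * w * (2 * x + \<i>)) ^ 3"
      unfolding eventually_strip_ends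
    proof (intro exI[of _ B] ballI impI)
      fix x assume x: "x \<in> strip" "B \<le> \<bar>Re x\<bar>"
      then have "x \<notin> Z" using B in_strip by (force simp: Z_def)
      then show "g x = F (of_real a * x * (x + \<i>)) / sinh (of_real pi * w * (2 * x + \<i>)) ^ 3"
        using g_eq[of x] x V(2) by (auto simp: G_eq h_def add.commute)
    qed
    then show ?thesis using assms(10) by (simp add: tendsto_cong)
  qed
  have P: "finite P" "\<And>p. p \<in> P \<Longrightarrow> -1 < Im p \<and> Im p < 0"
    by (auto simp: P_def N_def)
  have f: "f = (\<lambda>x. g (of_real x))"
    by (simp add: f_def g_def G_def)
  have integrable: "line_integrable f"
    unfolding f by (rule strip_integral_residues(1)[OF W P(1) _ g_holo g_odd g_ends]) (rule P(2))
  have integral: "line_integral f = - (of_real pi * \<i> * (\<Sum>p\<in>P. residue g p))"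
    unfolding f by (rule strip_integral_residues(2)[OF W P(1) _ g_holo g_odd g_ends]) (rule P(2))

  \<comment> \<open>The residue at the \<open>n\<close>-th zero. It is written through \<open>\<bar>n\<bar>\<close>, so that it is visibly even
    in \<open>n\<close> and matches the natural index of the sums in the result.\<close>
  define \<rho> where "\<rho> n = (-1) ^ nat \<bar>n\<bar> * ((2 * of_real a * deriv F (X (nat \<bar>n\<bar>) / 4)
      - (of_real a * of_nat (nat \<bar>n\<bar>) / w)\<^sup>2 * deriv (deriv F) (X (nat \<bar>n\<bar>) / 4)) / (2 * of_real pi * w)\<^sup>2
      - F (X (nat \<bar>n\<bar>) / 4)) / (4 * of_real pi * w)" for n :: int
  have res: "residue g (csch_pole w n) = \<rho> n" if n: "n \<in> N" for n
  proof -
    define p where "p = csch_pole w n"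
    define k where "k = nat \<bar>n\<bar>"
    define c where "c = 2 * of_real pi * w"
    have c: "c \<noteq> 0" using w by (simp add: c_def)
    have p: "p \<in> V" using in_strip n V(2) by (auto simp: p_def)
    have arg: "c * x + of_real pi * w * \<i> = of_real pi * w * (\<i> + 2 * x)" for x
      by (simp add: c_def algebra_simps)
    have sq: "(of_int n)\<^sup>2 = (of_nat k :: complex)\<^sup>2"
      by (cases "n \<ge> 0") (auto simp: k_def)
    have arg_p: "c * p + of_real pi * w * \<i> = \<i> * of_real (pi * of_int n)"
      using w(1) by (simp add: c_def p_def csch_pole_def field_simps)
    have "p \<in> Z" by (simp add: p_def Z_def)
    then have "sinh (c * p + of_real pi * w * \<i>) = 0" by (simp add: arg Z)
    from residue_over_sinh_cubed[OF V(1) p Fh c this]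
    have "residue G p = (deriv (deriv (\<lambda>x. F (h x))) p / c\<^sup>2 - F (h p)) / (2 * c * cosh (c * p + of_real pi * w * \<i>))"
      by (simp add: arg G_eq[abs_def])
    also have "cosh (c * p + of_real pi * w * \<i>) = (-1) ^ k"
    proof -
      have "cosh (c * p + of_real pi * w * \<i>) = cos (of_real (pi * of_int n))"
        unfolding arg_p by (simp add: cosh_conv_cos)
      also have "\<dots> = of_real (cos (pi * of_int n))" by (simp only: cos_of_real)
      also have "cos (pi * of_int n) = cos (pi * of_nat k)"
        by (cases "n \<ge> 0") (auto simp: k_def)
      also have "\<dots> = (-1) ^ k" by (rule cos_npi2)
      finally show ?thesis by simp
    qed
    also have "deriv (deriv (\<lambda>x. F (h x))) p
        = (of_real a * (2 * p + \<i>))\<^sup>2 * deriv (deriv F) (h p) + 2 * of_real a * deriv F (h p)"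
      unfolding h_def using deriv_deriv_comp_parabola[OF assms(6) F, of "of_real a" p] p
      by (simp add: V_def h_def)
    also have "h p = X k / 4"
    proof -
      have "h p = of_real a * (w\<^sup>2 - (of_int n)\<^sup>2) / w\<^sup>2 / 4"
        using w(1) by (simp add: h_def p_def csch_pole_def field_simps power2_eq_square)
      also have "\<dots> = X k / 4"
        unfolding X_def sq by (simp add: power2_eq_square algebra_simps)
      finally show ?thesis .
    qed
    also have "(of_real a * (2 * p + \<i>))\<^sup>2 = - (of_real a * of_nat k / w)\<^sup>2"
    proof -
      have "2 * p + \<i> = \<i> * (of_int n / w)"
        using w(1) by (simp add: p_def csch_pole_def field_simps)
      then show ?thesis by (simp add: power_mult_distrib power_divide sq)
    qed
    finally have "residue G p = \<rho> n"
      unfolding \<rho>_def c_def k_def[symmetric] using w(1)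
      by (cases "even k") (simp_all add: field_simps)
    moreover have "isolated_singularity_at G p"
      using G_mero p by (auto simp: meromorphic_on_altdef)
    ultimately show ?thesis by (simp add: g_def p_def)
  qed
  \<comment> \<open>A zero on the edge of the strip (\<open>n = \<plusminus>M\<close>) is a regular point of \<open>g\<close>, so its residue vanishes
    and the sum may run over all of \<open>-M..M\<close>, as it does in the closed form.\<close>
  have "(\<Sum>p\<in>P. residue g p) = (\<Sum>p\<in>csch_pole w ` N. residue g p)"
  proof (rule sum.mono_neutral_left)
    show "\<forall>p\<in>csch_pole w ` N - P. residue g p = 0"
    proof
      fix p assume p: "p \<in> csch_pole w ` N - P"
      then have "p \<in> strip" using in_strip by auto
      then have "Im p = 0 \<or> Im p = -1" using p by (auto simp: P_def strip_def)
      then have "g analytic_on {p}" using g_real g_lower by blast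
      then obtain S where "open S" "p \<in> S" "g holomorphic_on S" by (auto simp: analytic_at)
      then show "residue g p = 0" by (rule residue_holo)
    qed
  qed (auto simp: P_def N_def)
  also have "\<dots> = (\<Sum>n\<in>N. residue g (csch_pole w n))"
    using w(1) by (subst sum.reindex) (auto simp: inj_on_def csch_pole_def)
  also have "\<dots> = (\<Sum>n\<in>N. \<rho> n)"
    by (intro sum.cong refl res)
  also have "\<dots> = \<rho> 0 + 2 * (\<Sum>n=1..M. \<rho> (int n))"
    unfolding N_def m_def by (rule sum_even_int) (simp add: \<rho>_def)
  finally have "of_real pi * line_integral f
      = - (\<i> * of_real pi ^ 2 * \<rho> 0) + (\<Sum>n=1..M. - (2 * \<i> * of_real pi ^ 2) * \<rho> (int n))"
    unfolding integral sum_distrib_left[symmetric] by (simp add: power2_eq_square algebra_simps)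
  also have "- (\<i> * of_real pi ^ 2 * \<rho> 0)
      = \<i> * of_real pi / 4 * (F (of_real a / 4) / w)
        - \<i> * of_real a / (8 * of_real pi * w ^ 3) * deriv F (of_real a / 4)"
    using w(1) by (simp add: \<rho>_def X_def field_simps power2_eq_square power3_eq_cube)
  also have "(\<lambda>n. - (2 * \<i> * of_real pi ^ 2) * \<rho> (int n))
      = (\<lambda>n. \<i> * of_real pi / (2 * w) * ((-1) ^ n * F (X n / 4))
           - \<i> * of_real a / (4 * of_real pi * w ^ 3) * ((-1) ^ n * deriv F (X n / 4))
           + \<i> * of_real (a\<^sup>2) / (8 * of_real pi * w ^ 5)
             * ((-1) ^ n * of_nat (n\<^sup>2) * deriv (deriv F) (X n / 4)))"
    using w(1) by (simp add: \<rho>_def fun_eq_iff field_simps eval_nat_numeral)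
  finally show ?thesis
    using integrable by (simp only: sum.distrib sum_subtractf sum_distrib_left[symmetric] simp_thms
        add_diff_eq add.assoc[symmetric])
qed

end
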